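(* Let $n\ge1$, let $P_{X^nY^n}$ be a joint distribution on $\mathcal X_n\times\mathcal Y^n$ with $\mathcal X_n,\mathcal Y$ finite, and let $\chi$ be the uniform distribution on $\mathcal Y$. Let $\eta$ and $\gamma$ be positive numbers. Consider WAK-codes for $P_{X^nY^n}$ and testing schemes for the U-HT problem, as defined in the context. (i) From any WAK-code $(\phi_{1n},\phi_{2n},\bar\psi_n)$ with $\phi_{2n}:\mathcal Y^n\to\mathcal M_2$ one can construct a U-HT testing scheme $(\phi_{1n},\psi_n)$ (with the same compression map $\phi_{1n}$) such that $$\alpha_n\le\Pr\{\hat Y^n\ne Y^n\}+e^{-\eta},\qquad \beta_n\le\frac{e^{\eta}|\mathcal M_2|}{|\mathcal Y|^n}.$$ (ii) For any U-HT testing scheme $(\phi_n,\psi_n)$ and any nonempty finite set $\mathcal M_2$ there exists a WAK-code $(\phi_{1n},\phi_{2n},\bar\psi_n)$ with $\phi_{2n}:\mathcal Y^n\to\mathcal M_2$ such that $$\Pr\{\hat Y^n\ne Y^n\}\le\alpha_n+\gamma\beta_n+\frac{|\mathcal Y|^n}{\gamma|\mathcal M_2|}.$$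
   Context: WAK (Wyner–Ahlswede–Körner) problem: $(X^n,Y^n)\sim P_{X^nY^n}$. A WAK-code is a triple of maps $\phi_{1n}:\mathcal X_n\to\mathcal M_1$, $\phi_{2n}:\mathcal Y^n\to\mathcal M_2$, $\bar\psi_n:\mathcal M_1\times\mathcal M_2\to\mathcal Y^n$, with $\mathcal M_1,\mathcal M_2$ finite sets; $\hat Y^n=\bar\psi_n(\phi_{1n}(X^n),\phi_{2n}(Y^n))$, and the error probability is $\Pr\{\hat Y^n\neq Y^n\}$. U-HT problem: test $H_0:(y^n,x^n)\sim P_{Y^nX^n}$ (the same joint law) against $H_1:(y^n,x^n)\sim\chi^{\otimes n}\times P_{X^n}$, where $P_{X^n}$ is the $\mathcal X_n$-marginal. A testing scheme is a pair $(\phi_n,\psi_n)$ with $\phi_n:\mathcal X_n\to\mathcal M$ ($\mathcal M$ finite) and a possibly randomized decision map $\psi_n:\mathcal Y^n\times\mathcal M\to\{0,1\}$ (output $0$ means deciding $H_0$). The error probabilities are $\alpha_n=$ the probability that $\psi_n(Y^n,\phi_n(X^n))=1$ under $H_0$, and $\beta_n=$ the probability that $\psi_n(Y^n,\phi_n(X^n))=0$ under $H_1$. *)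

theory Defs
  imports "HOL-Probability.Probability"
begin

definition seqs :: "nat \<Rightarrow> 'a set \<Rightarrow> 'a list set" where
  "seqs n A = {xs \<in> lists A. length xs = n}"

definition wak_code ::
  "'x set \<Rightarrow> 'y set \<Rightarrow> nat \<Rightarrow> 'm1 set \<Rightarrow> 'm2 set \<Rightarrow>
   ('x \<Rightarrow> 'm1) \<Rightarrow> ('y list \<Rightarrow> 'm2) \<Rightarrow> ('m1 \<Rightarrow> 'm2 \<Rightarrow> 'y list) \<Rightarrow> bool" where
  "wak_code X Y n M1 M2 \<phi>1 \<phi>2 \<psi> \<longleftrightarrow>
     finite M1 \<and> finite M2 \<and>
     \<phi>1 \<in> X \<rightarrow> M1 \<and> \<phi>2 \<in> seqs n Y \<rightarrow> M2 \<and> \<psi> \<in> M1 \<rightarrow> M2 \<rightarrow> seqs n Y"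

definition wak_error ::
  "('x \<times> 'y list) pmf \<Rightarrow> ('x \<Rightarrow> 'm1) \<Rightarrow> ('y list \<Rightarrow> 'm2) \<Rightarrow>
   ('m1 \<Rightarrow> 'm2 \<Rightarrow> 'y list) \<Rightarrow> real" where
  "wak_error P \<phi>1 \<phi>2 \<psi> = measure_pmf.prob P {(x, y). \<psi> (\<phi>1 x) (\<phi>2 y) \<noteq> y}"

text \<open>A randomized decision map assigns to each pair of a sequence and a message a
  distribution on the two decisions 0 (accept the null hypothesis) and 1 (reject it).
  Its internal randomness is independent of the observations.\<close>

definition testing_scheme ::
  "'x set \<Rightarrow> 'y set \<Rightarrow> nat \<Rightarrow> 'm set \<Rightarrow>
   ('x \<Rightarrow> 'm) \<Rightarrow> ('y list \<Rightarrow> 'm \<Rightarrow> nat pmf) \<Rightarrow> bool" where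
  "testing_scheme X Y n M \<phi> \<psi> \<longleftrightarrow>
     finite M \<and> \<phi> \<in> X \<rightarrow> M \<and>
     (\<forall>y\<in>seqs n Y. \<forall>m\<in>M. set_pmf (\<psi> y m) \<subseteq> {0, 1})"

definition decision_pmf ::
  "('x \<times> 'y list) pmf \<Rightarrow> ('x \<Rightarrow> 'm) \<Rightarrow> ('y list \<Rightarrow> 'm \<Rightarrow> nat pmf) \<Rightarrow> nat pmf" where
  "decision_pmf Q \<phi> \<psi> = bind_pmf Q (\<lambda>(x, y). \<psi> y (\<phi> x))"

text \<open>The alternative hypothesis: the two components are independent, the first with its
  marginal under \<open>P\<close>, the second i.i.d. uniform on \<open>Y\<close>.\<close>

definition alternative :: "'y set \<Rightarrow> nat \<Rightarrow> ('x \<times> 'y list) pmf \<Rightarrow> ('x \<times> 'y list) pmf" where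
  "alternative Y n P = pair_pmf (map_pmf fst P) (replicate_pmf n (pmf_of_set Y))"

definition type1_error ::
  "('x \<times> 'y list) pmf \<Rightarrow> ('x \<Rightarrow> 'm) \<Rightarrow> ('y list \<Rightarrow> 'm \<Rightarrow> nat pmf) \<Rightarrow> real" where
  "type1_error P \<phi> \<psi> = pmf (decision_pmf P \<phi> \<psi>) 1"

definition type2_error ::
  "'y set \<Rightarrow> nat \<Rightarrow> ('x \<times> 'y list) pmf \<Rightarrow>
   ('x \<Rightarrow> 'm) \<Rightarrow> ('y list \<Rightarrow> 'm \<Rightarrow> nat pmf) \<Rightarrow> real" where
  "type2_error Y n P \<phi> \<psi> = pmf (decision_pmf (alternative Y n P) \<phi> \<psi>) 0"

end

theory Submission
  imports Defs
begin

text \<open>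
  (i) Accept \<open>y\<close> on message \<open>m\<close> iff the code recovers \<open>y\<close> from \<open>m\<close> and its own bin index.
  The type I error is then the decoding error, and at most \<open>card M2\<close> sequences are accepted
  for each message, so even the bounds without \<open>\<eta>\<close> hold.

  (ii) Let \<open>N = card Y ^ n\<close>, let \<open>Q\<close> be the joint law of message and sequence, and let \<open>T m\<close>
  be the set of \<open>y\<close> with \<open>Q (m, y) > \<gamma> / N * Q m\<close>. As \<open>\<alpha> + \<gamma> \<beta>\<close> is at least the sum of
  \<open>min (Q (m, y)) (\<gamma> / N * Q m)\<close>, it bounds the probability of \<open>y \<notin> T m\<close>. Each \<open>T m\<close> has at most
  \<open>N / \<gamma>\<close> elements, so binning the sequences into \<open>card M2\<close> bins and decoding within \<open>T m\<close>
  produces a collision with probability at most \<open>N / (\<gamma> * card M2)\<close> on average over the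
  binnings; the binning is derandomized by choosing bins one sequence at a time.
\<close>

section \<open>Sequences of fixed length\<close>

lemma seqs_eq: "seqs n Y = {xs. set xs \<subseteq> Y \<and> length xs = n}"
  by (auto simp: seqs_def)

lemma finite_seqs: "finite Y \<Longrightarrow> finite (seqs n Y)"
  by (simp add: seqs_eq finite_lists_length_eq)

lemma card_seqs: "finite Y \<Longrightarrow> card (seqs n Y) = card Y ^ n"
  by (simp add: seqs_eq card_lists_length_eq)

section \<open>Derandomized binning\<close>

lemma sum_off_diagonal_insert:
  fixes f :: "'a \<Rightarrow> 'a \<Rightarrow> real"
  assumes "finite S" "a \<notin> S"
  shows "(\<Sum>y\<in>insert a S. \<Sum>z\<in>insert a S - {y}. f y z) =
         (\<Sum>y\<in>S. \<Sum>z\<in>S - {y}. f y z) + (\<Sum>y\<in>S. f y a + f a y)"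
proof -
  have "(\<Sum>z\<in>insert a S - {y}. f y z) = f y a + (\<Sum>z\<in>S - {y}. f y z)" if "y \<in> S" for y
  proof -
    have "insert a S - {y} = insert a (S - {y})" using that assms by auto
    then show ?thesis using assms by simp
  qed
  moreover have "insert a S - {a} = S" using assms by auto
  ultimately show ?thesis using assms by (simp add: sum.distrib)
qed

lemma exists_le_average:
  fixes f :: "'a \<Rightarrow> real"
  assumes "finite M" "M \<noteq> {}"
  obtains b where "b \<in> M" "f b \<le> (\<Sum>b\<in>M. f b) / card M"
proof -
  have "\<exists>b\<in>M. f b \<le> (\<Sum>b\<in>M. f b) / card M"
  proof (rule ccontr)
    assume "\<not> ?thesis"
    then have "(\<Sum>c\<in>M. (\<Sum>b\<in>M. f b) / card M) < (\<Sum>b\<in>M. f b)"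
      using assms by (intro sum_strict_mono) auto
    then show False using assms by simp
  qed
  then show ?thesis using that by blast
qed

text \<open>Under a uniformly random \<open>g\<close>, two distinct elements collide with
  probability \<open>1 / card M\<close>, so the right side is the expected weight of the collisions.
  The induction places each new element in a bin that adds no more than the average, so no
  probability space of binnings is built.\<close>

lemma exists_binning:
  fixes w :: "'a \<Rightarrow> 'a \<Rightarrow> real" and M :: "'b set"
  assumes S: "finite S" and M: "finite M" "M \<noteq> {}"
  shows "\<exists>g\<in>S \<rightarrow> M. (\<Sum>y\<in>S. \<Sum>z\<in>S - {y}. w y z * of_bool (g z = g y))
           \<le> (\<Sum>y\<in>S. \<Sum>z\<in>S - {y}. w y z) / card M"
  using S
proof (induction S)
  case empty
  then show ?case by simp
next
  case (insert a S)
  then obtain g where g: "g \<in> S \<rightarrow> M"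
    and le: "(\<Sum>y\<in>S. \<Sum>z\<in>S - {y}. w y z * of_bool (g z = g y))
           \<le> (\<Sum>y\<in>S. \<Sum>z\<in>S - {y}. w y z) / card M" by blast
  \<comment> \<open>\<open>v y\<close> is the weight of the two ordered pairs formed by
    \<open>y\<close> and the new element \<open>a\<close>; putting \<open>a\<close> in bin
    \<open>b\<close> adds exactly the \<open>v y\<close> with \<open>g y = b\<close>.\<close>
  define v where "v y = w y a + w a y" for y
  obtain b where b: "b \<in> M"
    "(\<Sum>y\<in>S. v y * of_bool (g y = b)) \<le> (\<Sum>b\<in>M. \<Sum>y\<in>S. v y * of_bool (g y = b)) / card M"
    using exists_le_average[OF M] .
  \<comment> \<open>Each \<open>y\<close> lies in exactly one bin, so the costs of all choices of
    \<open>b\<close> add up to the total of \<open>v\<close>.\<close>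
  have "(\<Sum>b\<in>M. \<Sum>y\<in>S. v y * of_bool (g y = b)) = (\<Sum>y\<in>S. \<Sum>b\<in>M. v y * of_bool (g y = b))"
    by (rule sum.swap)
  also have "\<dots> = (\<Sum>y\<in>S. v y)"
  proof (rule sum.cong)
    fix y assume "y \<in> S"
    then have "g y \<in> M" using g by auto
    then show "(\<Sum>b\<in>M. v y * of_bool (g y = b)) = v y"
      using M(1) by (simp add: of_bool_def if_distrib cong: if_cong)
  qed simp
  finally have avg: "(\<Sum>y\<in>S. v y * of_bool (g y = b)) \<le> (\<Sum>y\<in>S. v y) / card M"
    using b(2) by simp
  let ?h = "g(a := b)"
  have h: "?h y = g y" if "y \<in> S" for y
    using that insert.hyps by auto
  have "(\<Sum>y\<in>insert a S. \<Sum>z\<in>insert a S - {y}. w y z * of_bool (?h z = ?h y))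
      = (\<Sum>y\<in>S. \<Sum>z\<in>S - {y}. w y z * of_bool (?h z = ?h y))
        + (\<Sum>y\<in>S. w y a * of_bool (?h a = ?h y) + w a y * of_bool (?h y = ?h a))"
    using insert.hyps by (rule sum_off_diagonal_insert)
  also have "\<dots> = (\<Sum>y\<in>S. \<Sum>z\<in>S - {y}. w y z * of_bool (g z = g y))
        + (\<Sum>y\<in>S. v y * of_bool (g y = b))"
    by (intro arg_cong2[of _ _ _ _ "(+)"] sum.cong refl)
      (use h in \<open>auto simp: v_def\<close>)
  also have "\<dots> \<le> ((\<Sum>y\<in>S. \<Sum>z\<in>S - {y}. w y z) + (\<Sum>y\<in>S. v y)) / card M"
    using le avg by (simp add: add_divide_distrib)
  also have "\<dots> = (\<Sum>y\<in>insert a S. \<Sum>z\<in>insert a S - {y}. w y z) / card M"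
    by (subst sum_off_diagonal_insert) (use insert.hyps in \<open>auto simp: v_def\<close>)
  finally have "(\<Sum>y\<in>insert a S. \<Sum>z\<in>insert a S - {y}. w y z * of_bool (?h z = ?h y))
      \<le> (\<Sum>y\<in>insert a S. \<Sum>z\<in>insert a S - {y}. w y z) / card M" .
  moreover have "?h \<in> insert a S \<rightarrow> M" using g b(1) by auto
  ultimately show ?case by blast
qed

section \<open>The uniform law on sequences\<close>

lemma pmf_replicate_pmf_of_set:
  assumes "finite Y" "Y \<noteq> {}" "y \<in> seqs n Y"
  shows "pmf (replicate_pmf n (pmf_of_set Y)) y = 1 / real (card Y) ^ n"
  using assms(3)
proof (induction n arbitrary: y)
  case 0
  then show ?case by (simp add: seqs_def)
next
  case (Suc n)
  then obtain a u where y: "y = a # u" "a \<in> Y" "u \<in> seqs n Y"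
    by (cases y) (auto simp: seqs_def)
  \<comment> \<open>As an image of a product law under an injective map, the law has point masses
    that factor into head and tail.\<close>
  have *: "replicate_pmf (Suc n) (pmf_of_set Y) =
    map_pmf (\<lambda>(x, xs). x # xs) (pair_pmf (pmf_of_set Y) (replicate_pmf n (pmf_of_set Y)))"
    by (simp add: pair_pmf_def map_bind_pmf)
  have "pmf (replicate_pmf (Suc n) (pmf_of_set Y)) y =
    pmf (pair_pmf (pmf_of_set Y) (replicate_pmf n (pmf_of_set Y))) (a, u)"
    unfolding * using y(1)
    by (subst pmf_map_inj'[symmetric, where f = "\<lambda>(x, xs). x # xs"]) (auto intro!: injI)
  then show ?case using Suc.IH[OF y(3)] y assms(1,2) by (simp add: pmf_pair)
qed

section \<open>Reduction to the joint law of message and sequence\<close>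

text \<open>Decisions see the source only through its message. Pushing the source law forward along
  the encoder therefore allows the encoder to be replaced by \<open>id\<close>, here and for all
  three error probabilities.\<close>

lemma decision_pmf_map: "decision_pmf (map_pmf (apfst f) P) id \<psi> = decision_pmf P f \<psi>"
  by (simp add: decision_pmf_def bind_map_pmf case_prod_unfold)

text \<open>The encoder acts on the first component alone, so it commutes with replacing the joint
  law by the product of its first marginal and the uniform law.\<close>

lemma alternative_map: "alternative Y n (map_pmf (apfst f) P) = map_pmf (apfst f) (alternative Y n P)"
proof -
  have "map_pmf fst (map_pmf (apfst f) P) = map_pmf f (map_pmf fst P)"
    by (simp add: map_pmf_comp)
  then show ?thesis by (simp add: alternative_def pair_map_pmf1)
qed

lemma type1_error_map: "type1_error (map_pmf (apfst f) P) id \<psi> = type1_error P f \<psi>"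
  by (simp add: type1_error_def decision_pmf_map)

lemma type2_error_map: "type2_error Y n (map_pmf (apfst f) P) id \<psi> = type2_error Y n P f \<psi>"
  by (simp add: type2_error_def alternative_map decision_pmf_map)

lemma wak_error_map: "wak_error (map_pmf (apfst f) P) id \<phi>2 \<psi> = wak_error P f \<phi>2 \<psi>"
  by (simp add: wak_error_def vimage_def case_prod_unfold)

lemma pmf_decision_pmf:
  assumes "finite A" "set_pmf Q \<subseteq> A"
  shows "pmf (decision_pmf Q \<phi> \<psi>) i = (\<Sum>(x, y)\<in>A. pmf Q (x, y) * pmf (\<psi> y (\<phi> x)) i)"
  unfolding decision_pmf_def pmf_bind
  by (subst integral_measure_pmf_real[OF assms(1)])
    (use assms(2) in \<open>auto simp: split_beta mult.commute\<close>)

section \<open>Error probabilities as finite sums over messages and sequences\<close>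

context
  fixes M :: "'m set" and Y :: "'y set" and n :: nat and Q :: "('m \<times> 'y list) pmf"
  assumes fin: "finite M" "finite Y" and ne: "Y \<noteq> {}"
    and supp: "set_pmf Q \<subseteq> M \<times> seqs n Y"
begin

lemma finite_support: "finite (M \<times> seqs n Y)"
  using fin by (simp add: finite_seqs)

lemma type1_error_sum:
  "type1_error Q id \<psi> = (\<Sum>m\<in>M. \<Sum>y\<in>seqs n Y. pmf Q (m, y) * pmf (\<psi> y m) 1)"
  unfolding type1_error_def
  by (simp add: pmf_decision_pmf[OF finite_support supp] sum.cartesian_product)

lemma type2_error_sum:
  "type2_error Y n Q id \<psi> =
    (\<Sum>m\<in>M. \<Sum>y\<in>seqs n Y. pmf (map_pmf fst Q) m / real (card Y) ^ n * pmf (\<psi> y m) 0)"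
proof -
  have "set_pmf (alternative Y n Q) \<subseteq> M \<times> seqs n Y"
    using supp fin ne by (auto simp: alternative_def set_replicate_pmf seqs_def)
  then show ?thesis
    unfolding type2_error_def
    by (auto simp: pmf_decision_pmf[OF finite_support] sum.cartesian_product alternative_def
        pmf_pair pmf_replicate_pmf_of_set fin ne intro!: sum.cong)
qed

lemma wak_error_sum:
  "wak_error Q id \<phi>2 \<psi> =
    (\<Sum>m\<in>M. \<Sum>y\<in>seqs n Y. pmf Q (m, y) * of_bool (\<psi> m (\<phi>2 y) \<noteq> y))"
proof -
  let ?E = "{(m, y). \<psi> m (\<phi>2 y) \<noteq> y}"
  have "wak_error Q id \<phi>2 \<psi> = (\<integral>x. indicator ?E x \<partial>measure_pmf Q)"
    by (simp add: wak_error_def)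
  also have "\<dots> = (\<Sum>(m, y)\<in>M \<times> seqs n Y. indicator ?E (m, y) * pmf Q (m, y))"
    by (subst integral_measure_pmf_real[OF finite_support]) (use supp in auto)
  also have "\<dots> = (\<Sum>m\<in>M. \<Sum>y\<in>seqs n Y. pmf Q (m, y) * of_bool (\<psi> m (\<phi>2 y) \<noteq> y))"
    by (auto simp: sum.cartesian_product intro!: sum.cong)
  finally show ?thesis .
qed

lemma sum_pmf_marginal: "(\<Sum>m\<in>M. pmf (map_pmf fst Q) m) = 1"
  by (rule sum_pmf_eq_1) (use fin supp in auto)

lemma pmf_marginal: "pmf (map_pmf fst Q) m = (\<Sum>y\<in>seqs n Y. pmf Q (m, y))"
proof -
  have "pmf (map_pmf fst Q) m = measure Q (fst -` {m} \<inter> set_pmf Q)"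
    by (simp add: pmf_map measure_Int_set_pmf)
  also have "fst -` {m} \<inter> set_pmf Q = Pair m ` seqs n Y \<inter> set_pmf Q"
    using supp by auto
  also have "measure Q \<dots> = (\<Sum>x\<in>Pair m ` seqs n Y. pmf Q x)"
    using fin by (simp add: measure_Int_set_pmf measure_measure_pmf_finite finite_seqs)
  also have "\<dots> = (\<Sum>y\<in>seqs n Y. pmf Q (m, y))"
    by (subst sum.reindex) (auto intro: inj_onI)
  finally show ?thesis .
qed

section \<open>From codes to tests\<close>

lemma exists_test:
  assumes code: "wak_code M Y n M M2 id \<phi>2 \<psi>bar"
  shows "\<exists>\<psi>. testing_scheme M Y n M id \<psi> \<and>
           type1_error Q id \<psi> = wak_error Q id \<phi>2 \<psi>bar \<and>
           type2_error Y n Q id \<psi> \<le> real (card M2) / real (card Y) ^ n"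
proof (intro exI conjI)
  let ?\<psi> = "\<lambda>y m. return_pmf (if \<psi>bar m (\<phi>2 y) = y then 0 else 1 :: nat)"
  show "testing_scheme M Y n M id ?\<psi>"
    using fin by (auto simp: testing_scheme_def)
  show "type1_error Q id ?\<psi> = wak_error Q id \<phi>2 \<psi>bar"
    by (auto simp: type1_error_sum wak_error_sum intro!: sum.cong)
  have M2: "finite M2" "\<phi>2 \<in> seqs n Y \<rightarrow> M2"
    using code by (auto simp: wak_code_def)
  have "(\<Sum>y\<in>seqs n Y. pmf (?\<psi> y m) 0) \<le> real (card M2)" for m
  proof -
    have "(\<Sum>y\<in>seqs n Y. pmf (?\<psi> y m) 0) = (\<Sum>y\<in>seqs n Y. of_bool (\<psi>bar m (\<phi>2 y) = y))"
      by (auto intro!: sum.cong)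
    also have "\<dots> = real (card {y \<in> seqs n Y. \<psi>bar m (\<phi>2 y) = y})"
      using fin by (simp add: finite_seqs Int_def)
    \<comment> \<open>An accepted \<open>y\<close> is the decoder output for \<open>m\<close> and
      the bin \<open>\<phi>2 y\<close>.\<close>
    also have "card {y \<in> seqs n Y. \<psi>bar m (\<phi>2 y) = y} \<le> card (\<psi>bar m ` M2)"
    proof (rule card_mono)
      show "{y \<in> seqs n Y. \<psi>bar m (\<phi>2 y) = y} \<subseteq> \<psi>bar m ` M2"
        using M2(2) by (auto intro: rev_image_eqI)
    qed (use M2 in simp)
    also have "\<dots> \<le> card M2" using M2(1) by (rule card_image_le)
    finally show ?thesis by simp
  qed
  then have "type2_error Y n Q id ?\<psi>
      \<le> (\<Sum>m\<in>M. pmf (map_pmf fst Q) m / real (card Y) ^ n * real (card M2))"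
    unfolding type2_error_sum sum_distrib_left[symmetric]
    by (intro sum_mono mult_left_mono) auto
  also have "\<dots> = real (card M2) / real (card Y) ^ n"
    using sum_pmf_marginal
    by (simp add: sum_distrib_right[symmetric] sum_divide_distrib[symmetric])
  finally show "type2_error Y n Q id ?\<psi> \<le> real (card M2) / real (card Y) ^ n" .
qed

section \<open>From tests to codes\<close>

lemma exists_wak_code:
  assumes test: "testing_scheme M Y n M id \<psi>"
    and M2: "finite M2" "M2 \<noteq> {}" and \<gamma>: "\<gamma> > 0"
  shows "\<exists>\<phi>2 \<psi>bar. wak_code M Y n M M2 id \<phi>2 \<psi>bar \<and>
           wak_error Q id \<phi>2 \<psi>bar \<le> type1_error Q id \<psi> + \<gamma> * type2_error Y n Q id \<psi>
             + real (card Y) ^ n / (\<gamma> * real (card M2))"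
proof -
  let ?S = "seqs n Y"
  define N where "N = real (card Y) ^ n"
  define q where "q m = pmf (map_pmf fst Q) m" for m
  define T where "T m = {y \<in> ?S. pmf Q (m, y) > \<gamma> / N * q m}" for m
  have N: "N > 0" using fin ne by (simp add: N_def card_gt_0_iff)
  have q0: "q m \<ge> 0" for m by (simp add: q_def)
  have finS: "finite ?S" and finT: "finite (T m)" for m
    using fin by (auto simp: T_def finite_seqs)
  \<comment> \<open>\<open>w y z\<close> is the probability that \<open>y\<close> occurs with a
    message for which \<open>y\<close> and \<open>z\<close> are both candidates. The messages are
    summed inside \<open>w\<close> because one binning has to serve all of them.\<close>
  define w where
    "w y z = (\<Sum>m\<in>M. pmf Q (m, y) * of_bool (y \<in> T m) * of_bool (z \<in> T m))" for y z
  obtain \<phi>2 where \<phi>2: "\<phi>2 \<in> ?S \<rightarrow> M2"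
    and coll: "(\<Sum>y\<in>?S. \<Sum>z\<in>?S - {y}. w y z * of_bool (\<phi>2 z = \<phi>2 y))
      \<le> (\<Sum>y\<in>?S. \<Sum>z\<in>?S - {y}. w y z) / card M2"
    using exists_binning[OF finS M2, of w] by blast
  obtain y0 where y0: "y0 \<in> ?S"
    using supp set_pmf_not_empty[of Q] by auto
  \<comment> \<open>The decoder returns the only candidate in the bin. The default \<open>y0\<close>
    keeps its values in \<open>seqs n Y\<close> when there is none or more than one.\<close>
  define \<psi>bar where "\<psi>bar m b =
    (if \<exists>!y. y \<in> T m \<and> \<phi>2 y = b then THE y. y \<in> T m \<and> \<phi>2 y = b else y0)" for m b
  have "\<psi>bar m b \<in> ?S" for m b
  proof (cases "\<exists>!y. y \<in> T m \<and> \<phi>2 y = b")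
    case True
    from theI'[OF True] show ?thesis using True by (simp add: \<psi>bar_def T_def)
  qed (use y0 in \<open>auto simp: \<psi>bar_def\<close>)
  then have code: "wak_code M Y n M M2 id \<phi>2 \<psi>bar"
    using fin M2 \<phi>2 by (auto simp: wak_code_def)

  \<comment> \<open>The elements of \<open>T m\<close> each carry mass above
    \<open>\<gamma> / N * q m\<close>, while their total mass is at most \<open>q m\<close>.\<close>
  have cardT: "real (card (T m)) \<le> N / \<gamma>" for m
  proof (cases "T m = {}")
    case True
    then show ?thesis using N \<gamma> by simp
  next
    case False
    have "real (card (T m)) * (\<gamma> / N * q m) = (\<Sum>y\<in>T m. \<gamma> / N * q m)" by simp
    also have "\<dots> \<le> (\<Sum>y\<in>T m. pmf Q (m, y))"
      by (intro sum_mono) (simp add: T_def)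
    also have "\<dots> \<le> (\<Sum>y\<in>?S. pmf Q (m, y))"
      by (intro sum_mono2 finS) (auto simp: T_def)
    also have "\<dots> = q m" by (simp add: q_def pmf_marginal)
    finally have *: "real (card (T m)) * \<gamma> / N * q m \<le> 1 * q m" by simp
    \<comment> \<open>Cancelling \<open>q m\<close> is legitimate: for a message of probability
      zero, the strict inequality in \<open>T\<close> leaves \<open>T m\<close> empty.\<close>
    have "q m \<noteq> 0"
    proof
      assume "q m = 0"
      then have "pmf Q (m, y) = 0" if "y \<in> ?S" for y
        using that finS by (simp add: q_def pmf_marginal sum_nonneg_eq_0_iff)
      then have "T m = {}" using \<open>q m = 0\<close> by (auto simp: T_def)
      with False show False by simp
    qed
    with q0[of m] have "q m > 0" by simp
    with * have "real (card (T m)) * \<gamma> / N \<le> 1" by (meson mult_le_cancel_right_pos)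
    then show ?thesis using N \<gamma> by (simp add: field_simps)
  qed

  \<comment> \<open>Outside \<open>T m\<close> the mass \<open>pmf Q (m, y)\<close> is at most
    \<open>\<gamma> / N * q m\<close>. It is split by the decision of the test, and only the share
    deciding 0 is replaced by this bound.\<close>
  have miss: "pmf Q (m, y) * of_bool (y \<notin> T m)
      \<le> pmf Q (m, y) * pmf (\<psi> y m) 1 + \<gamma> * (q m / N * pmf (\<psi> y m) 0)"
    if "m \<in> M" "y \<in> ?S" for m y
  proof -
    have "set_pmf (\<psi> y m) \<subseteq> {0, 1}"
      using test that by (auto simp: testing_scheme_def)
    from sum_pmf_eq_1[OF _ this] have one: "pmf (\<psi> y m) 1 = 1 - pmf (\<psi> y m) 0" by simp
    show ?thesis
    proof (cases "y \<in> T m")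
      case False
      then have "pmf Q (m, y) * pmf (\<psi> y m) 0 \<le> \<gamma> / N * q m * pmf (\<psi> y m) 0"
        using that by (intro mult_right_mono) (auto simp: T_def)
      then show ?thesis using False by (simp add: one[simplified] right_diff_distrib)
    qed (use \<gamma> N q0 in simp)
  qed

  \<comment> \<open>Union bound: decoding fails only if \<open>y\<close> is no candidate or another
    candidate \<open>z\<close> shares its bin.\<close>
  have err: "of_bool (\<psi>bar m (\<phi>2 y) \<noteq> y) \<le> of_bool (y \<notin> T m) +
      (\<Sum>z\<in>?S - {y}. of_bool (y \<in> T m) * of_bool (z \<in> T m) * of_bool (\<phi>2 z = \<phi>2 y) :: real)"
    (is "_ \<le> _ + ?R") for m y
  proof -
    have R0: "?R \<ge> 0" by (intro sum_nonneg) auto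
    consider "y \<notin> T m" | "\<psi>bar m (\<phi>2 y) = y"
      | z where "y \<in> T m" "z \<in> T m" "z \<noteq> y" "\<phi>2 z = \<phi>2 y"
    proof (cases "y \<in> T m \<and> (\<forall>z\<in>T m. \<phi>2 z = \<phi>2 y \<longrightarrow> z = y)")
      case True
      then have "\<exists>!z. z \<in> T m \<and> \<phi>2 z = \<phi>2 y" "(THE z. z \<in> T m \<and> \<phi>2 z = \<phi>2 y) = y"
        by auto
      then show ?thesis using that(2) by (simp add: \<psi>bar_def)
    qed (use that in blast)
    then show ?thesis
    proof cases
      case (3 z)
      have "1 = of_bool (y \<in> T m) * of_bool (z \<in> T m) * (of_bool (\<phi>2 z = \<phi>2 y) :: real)"
        using 3 by simp
      also have "\<dots> \<le> ?R"
        by (rule member_le_sum) (use 3 finS in \<open>auto simp: T_def\<close>)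
      finally have "1 \<le> ?R" .
      moreover have "of_bool (\<psi>bar m (\<phi>2 y) \<noteq> y) \<le> (1 :: real)"
        "0 \<le> (of_bool (y \<notin> T m) :: real)" by simp_all
      ultimately show ?thesis by linarith
    qed (use R0 in \<open>auto simp: of_bool_def\<close>)
  qed

  have "wak_error Q id \<phi>2 \<psi>bar \<le> (\<Sum>m\<in>M. \<Sum>y\<in>?S. pmf Q (m, y) * (of_bool (y \<notin> T m) +
      (\<Sum>z\<in>?S - {y}. of_bool (y \<in> T m) * of_bool (z \<in> T m) * of_bool (\<phi>2 z = \<phi>2 y))))"
    unfolding wak_error_sum by (intro sum_mono mult_left_mono err) auto
  also have "\<dots> = (\<Sum>m\<in>M. \<Sum>y\<in>?S. pmf Q (m, y) * of_bool (y \<notin> T m)) +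
      (\<Sum>m\<in>M. \<Sum>y\<in>?S. \<Sum>z\<in>?S - {y}.
        pmf Q (m, y) * of_bool (y \<in> T m) * of_bool (z \<in> T m) * of_bool (\<phi>2 z = \<phi>2 y))"
    by (simp add: distrib_left sum.distrib sum_distrib_left mult.assoc)
  also have "(\<Sum>m\<in>M. \<Sum>y\<in>?S. \<Sum>z\<in>?S - {y}.
        pmf Q (m, y) * of_bool (y \<in> T m) * of_bool (z \<in> T m) * of_bool (\<phi>2 z = \<phi>2 y)) =
      (\<Sum>y\<in>?S. \<Sum>z\<in>?S - {y}. w y z * of_bool (\<phi>2 z = \<phi>2 y))"
    unfolding w_def sum_distrib_right
    by (subst sum.swap, rule sum.cong[OF refl], rule sum.swap)
  also have "(\<Sum>m\<in>M. \<Sum>y\<in>?S. pmf Q (m, y) * of_bool (y \<notin> T m)) \<le>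
      (\<Sum>m\<in>M. \<Sum>y\<in>?S. pmf Q (m, y) * pmf (\<psi> y m) 1 + \<gamma> * (q m / N * pmf (\<psi> y m) 0))"
    by (intro sum_mono miss)
  also have "\<dots> = type1_error Q id \<psi> + \<gamma> * type2_error Y n Q id \<psi>"
    by (simp add: type1_error_sum type2_error_sum sum.distrib sum_distrib_left q_def N_def)
  also note coll
  \<comment> \<open>With the message sum moved outside again, the innermost sum counts the
    competitors of \<open>y\<close> in \<open>T m\<close>, which \<open>cardT\<close> bounds
    uniformly in \<open>m\<close>.\<close>
  also have "(\<Sum>y\<in>?S. \<Sum>z\<in>?S - {y}. w y z) =
      (\<Sum>m\<in>M. \<Sum>y\<in>?S. pmf Q (m, y) * of_bool (y \<in> T m) * (\<Sum>z\<in>?S - {y}. of_bool (z \<in> T m)))"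
    unfolding w_def sum_distrib_left
    by (subst (2) sum.swap, rule sum.cong[OF refl], rule sum.swap)
  also have "\<dots> \<le> (\<Sum>m\<in>M. \<Sum>y\<in>?S. pmf Q (m, y) * (N / \<gamma>))"
  proof (intro sum_mono mult_mono)
    fix m y
    have "(\<Sum>z\<in>?S - {y}. of_bool (z \<in> T m)) = real (card {z \<in> ?S - {y}. z \<in> T m})"
      using finS by (simp add: Int_def)
    also have "\<dots> \<le> real (card (T m))"
      using finT by (intro of_nat_mono card_mono) auto
    finally show "(\<Sum>z\<in>?S - {y}. of_bool (z \<in> T m)) \<le> N / \<gamma>"
      using cardT[of m] by linarith
  qed (auto intro: sum_nonneg)
  also have "\<dots> = N / \<gamma>"
    using sum_pmf_marginal
    by (simp add: pmf_marginal sum_distrib_right[symmetric] sum_divide_distrib[symmetric])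
  finally have "wak_error Q id \<phi>2 \<psi>bar
      \<le> type1_error Q id \<psi> + \<gamma> * type2_error Y n Q id \<psi> + N / \<gamma> / card M2"
    \<comment> \<open>The estimates were substituted inside sums and a quotient; the remaining goals
      are the monotonicity of these contexts.\<close>
    by this (simp_all add: divide_right_mono)
  with code show ?thesis by (auto simp: N_def simp del: id_apply)
qed

end

section \<open>Transfer to the original source\<close>

theorem theorem5:
  fixes n :: nat and X :: "'x set" and Y :: "'y set"
    and P :: "('x \<times> 'y list) pmf" and \<eta> \<gamma> :: real
  assumes "n \<ge> 1" and "finite X" and "finite Y"
    and "set_pmf P \<subseteq> X \<times> seqs n Y"
    and "\<eta> > 0" and "\<gamma> > 0"
  shows
    "(\<forall>(M1 :: 'm1 set) (M2 :: 'm2 set) \<phi>1 \<phi>2 \<psi>bar.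
        wak_code X Y n M1 M2 \<phi>1 \<phi>2 \<psi>bar \<longrightarrow>
        (\<exists>\<psi>. testing_scheme X Y n M1 \<phi>1 \<psi> \<and>
             type1_error P \<phi>1 \<psi> \<le> wak_error P \<phi>1 \<phi>2 \<psi>bar + exp (- \<eta>) \<and>
             type2_error Y n P \<phi>1 \<psi> \<le> exp \<eta> * real (card M2) / real (card Y) ^ n))
     \<and>
     (\<forall>(M :: 'm set) (M2 :: 'm2 set) \<phi> \<psi>.
        testing_scheme X Y n M \<phi> \<psi> \<longrightarrow> finite M2 \<longrightarrow> M2 \<noteq> {} \<longrightarrow>
        (\<exists>(M1 :: nat set) \<phi>1 \<phi>2 \<psi>bar.
             wak_code X Y n M1 M2 \<phi>1 \<phi>2 \<psi>bar \<and>
             wak_error P \<phi>1 \<phi>2 \<psi>bar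
               \<le> type1_error P \<phi> \<psi> + \<gamma> * type2_error Y n P \<phi> \<psi>
                 + real (card Y) ^ n / (\<gamma> * real (card M2))))"
proof (intro conjI allI impI)
  \<comment> \<open>The support of \<open>P\<close> contains a sequence of positive length, whose
    letters lie in \<open>Y\<close>.\<close>
  have ne: "Y \<noteq> {}"
    using assms(1,4) set_pmf_not_empty[of P] by (auto simp: seqs_def)
  {
    fix M1 :: "'m1 set" and M2 :: "'m2 set" and \<phi>1 \<phi>2 \<psi>bar
    assume code: "wak_code X Y n M1 M2 \<phi>1 \<phi>2 \<psi>bar"
    let ?Q = "map_pmf (apfst \<phi>1) P"
    have M1: "finite M1" "\<phi>1 \<in> X \<rightarrow> M1" using code by (auto simp: wak_code_def)
    have supp: "set_pmf ?Q \<subseteq> M1 \<times> seqs n Y" using M1(2) assms(4) by fastforce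
    have "wak_code M1 Y n M1 M2 id \<phi>2 \<psi>bar" using code by (auto simp: wak_code_def)
    from exists_test[OF M1(1) assms(3) ne supp this] obtain \<psi> where \<psi>:
      "testing_scheme M1 Y n M1 id \<psi>" "type1_error P \<phi>1 \<psi> = wak_error P \<phi>1 \<phi>2 \<psi>bar"
      "type2_error Y n P \<phi>1 \<psi> \<le> real (card M2) / real (card Y) ^ n"
      by (auto simp: type1_error_map type2_error_map wak_error_map)
    have "1 * (real (card M2) / real (card Y) ^ n) \<le> exp \<eta> * (real (card M2) / real (card Y) ^ n)"
      using assms(5) by (intro mult_right_mono) auto
    with \<psi>(3) have "type2_error Y n P \<phi>1 \<psi> \<le> exp \<eta> * real (card M2) / real (card Y) ^ n"
      by simp
    moreover have "testing_scheme X Y n M1 \<phi>1 \<psi>"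
      using \<psi>(1) M1 by (auto simp: testing_scheme_def)
    ultimately show "\<exists>\<psi>. testing_scheme X Y n M1 \<phi>1 \<psi> \<and>
             type1_error P \<phi>1 \<psi> \<le> wak_error P \<phi>1 \<phi>2 \<psi>bar + exp (- \<eta>) \<and>
             type2_error Y n P \<phi>1 \<psi> \<le> exp \<eta> * real (card M2) / real (card Y) ^ n"
      using \<psi>(2) by (intro exI[of _ \<psi>]) auto
  next
    fix M :: "'m set" and M2 :: "'m2 set" and \<phi> \<psi>
    assume test: "testing_scheme X Y n M \<phi> \<psi>" and M2: "finite M2" "M2 \<noteq> {}"
    let ?Q = "map_pmf (apfst \<phi>) P"
    have M: "finite M" "\<phi> \<in> X \<rightarrow> M" using test by (auto simp: testing_scheme_def)
    have supp: "set_pmf ?Q \<subseteq> M \<times> seqs n Y" using M(2) assms(4) by fastforce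
    have "testing_scheme M Y n M id \<psi>" using test by (auto simp: testing_scheme_def)
    from exists_wak_code[OF M(1) assms(3) ne supp this M2 assms(6)] obtain \<phi>2 \<psi>bar where code:
      "wak_code M Y n M M2 id \<phi>2 \<psi>bar"
      "wak_error P \<phi> \<phi>2 \<psi>bar \<le> type1_error P \<phi> \<psi> + \<gamma> * type2_error Y n P \<phi> \<psi>
         + real (card Y) ^ n / (\<gamma> * real (card M2))"
      by (auto simp: type1_error_map type2_error_map wak_error_map)
    \<comment> \<open>The code to be produced has natural numbers as messages, so those of the test
      are relabelled injectively and the decoder first undoes the relabelling.\<close>
    obtain e :: "'m \<Rightarrow> nat" where e: "inj_on e M"
      using finite_imp_inj_to_nat_seg[OF M(1)] by blast
    let ?\<psi>bar = "\<lambda>k. \<psi>bar (inv_into M e k)"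
    have "wak_code X Y n (e ` M) M2 (e \<circ> \<phi>) \<phi>2 ?\<psi>bar"
      using code(1) M e by (auto simp: wak_code_def Pi_iff)
    moreover have "wak_error P (e \<circ> \<phi>) \<phi>2 ?\<psi>bar = wak_error P \<phi> \<phi>2 \<psi>bar"
      unfolding wak_error_def
      \<comment> \<open>\<open>inv_into M e\<close> inverts \<open>e\<close> only on
        \<open>M\<close>, so the two error events are compared on the support of \<open>P\<close>,
        where all messages lie in \<open>M\<close>.\<close>
      by (rule measure_pmf.finite_measure_eq_AE)
        (use e M(2) assms(4) in \<open>auto simp: AE_measure_pmf_iff Pi_iff\<close>)
    ultimately show "\<exists>(M1 :: nat set) \<phi>1 \<phi>2 \<psi>bar.
             wak_code X Y n M1 M2 \<phi>1 \<phi>2 \<psi>bar \<and>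
             wak_error P \<phi>1 \<phi>2 \<psi>bar
               \<le> type1_error P \<phi> \<psi> + \<gamma> * type2_error Y n P \<phi> \<psi>
                 + real (card Y) ^ n / (\<gamma> * real (card M2))"
      using code(2) by metis
  }
qed

end
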